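(* Consider a dynamical network of $N$ linear time-invariant systems $G_1,\dots,G_N$ interconnected over an arbitrary directed graph $\Gamma=(\Omega,E)$ (the associated undirected graph $\hat\Gamma=(\Omega,\hat E)$ may contain cycles), with each $G_i$ of the form $$\dot x_i=A_ix_i+\sum_{j\in\mathcal N_i}B_{ij}v_{ij},\qquad w_{ij}=C_{ij}x_i\quad(j\in\mathcal N_i)$$ (i.e. all direct feed-through matrices $D_{ij}$ are zero). Suppose the network admits an additive quadratic Lyapunov function $V(x)=\sum_{i=1}^N x_i^\top P_ix_i$. Then the network is robustly stable with respect to removal (disconnection) of a system $G_i$ from the network: for every $i$, the network obtained by removing $G_i$ together with all edges of $\Gamma$ incident to it is stable.
   Context: Dynamical network. $\Gamma=(\Omega,E)$ is a finite directed graph (no self-loops) whose vertices $\Omega=\{G_1,\dots,G_N\}$ are linear time-invariant systems with states $x_i\in\mathbb{R}^{n_i}$. A directed edge $(G_i,G_j)\in E$ means that an output signal $w_{ij}$ of $G_i$ is an input signal $v_{ji}$ of $G_j$, with interconnection constraint $v_{ji}=w_{ij}$. The undirected graph $\hat\Gamma=(\Omega,\hat E)$ has an edge between $G_i$ and $G_j$ iff $(G_i,G_j)\in E$ or $(G_j,G_i)\in E$, and $\mathcal N_i=\{j:(G_i,G_j)\in\hat E\}$. If $(G_i,G_j)\notin E$, the signals $w_{ij}$ and $v_{ji}$ are absent (zero-dimensional). All matrices are real. With all interconnection constraints imposed, the network has the form $\dot x=\mathcal A x$, $x=\mathrm{col}(x_1,\dots,x_N)$. It admits an additive quadratic Lyapunov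 function $V(x)=\sum_i x_i^\top P_ix_i$ if the $P_i\in\mathbb{R}^{n_i\times n_i}$ are symmetric, $P_i\succ0$, and $\mathcal A^\top P+P\mathcal A\prec0$ with $P=\mathrm{diag}(P_1,\dots,P_N)$. "Stable" means asymptotically stable. After removal of $G_i$, the remaining systems $G_j$, $j\ne i$, keep all their mutual interconnections, and their inputs $v_{ji}$ coming from $G_i$ are set to zero. *)

theory Defs
  imports Complex_Main "Jordan_Normal_Form.Matrix" "Graph_Theory.Pair_Digraph"
begin

section \<open>Networks of linear time-invariant systems\<close>

text \<open>
  The vertices of the interconnection graph are labels of the systems; any finite set of
  natural numbers is allowed as label set, so that removing a system gives a network again.
  \<open>signal_dim G i j\<close> is the dimension of the output signal \<open>w i j\<close> of system \<open>i\<close>, and hence also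
  of the input signal \<open>v j i\<close> of system \<open>j\<close>.
\<close>

record lti_network =
  topology :: "nat pair_pre_digraph"
  state_dim :: "nat \<Rightarrow> nat"
  signal_dim :: "nat \<Rightarrow> nat \<Rightarrow> nat"
  A_mat :: "nat \<Rightarrow> real mat"
  B_mat :: "nat \<Rightarrow> nat \<Rightarrow> real mat"
  C_mat :: "nat \<Rightarrow> nat \<Rightarrow> real mat"

abbreviation systems :: "lti_network \<Rightarrow> nat set" where
  "systems G \<equiv> pverts (topology G)"

abbreviation edges :: "lti_network \<Rightarrow> (nat \<times> nat) set" where
  "edges G \<equiv> parcs (topology G)"

definition nbrs :: "lti_network \<Rightarrow> nat \<Rightarrow> nat set" where
  "nbrs G i = {j. (i, j) \<in> edges G \<or> (j, i) \<in> edges G}"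

text \<open>
  \<open>pair_digraph\<close> is the locale predicate of finite loop-free digraphs.  An absent signal is
  zero-dimensional, so for \<open>j \<in> nbrs G i\<close> with \<open>(j, i) \<notin> edges G\<close> the matrix \<open>B_mat G i j\<close> has no
  columns, and with \<open>(i, j) \<notin> edges G\<close> the matrix \<open>C_mat G i j\<close> has no rows.
\<close>

definition valid_network :: "lti_network \<Rightarrow> bool" where
  "valid_network G \<longleftrightarrow>
     pair_digraph (topology G) \<and>
     (\<forall>i\<in>systems G. \<forall>j\<in>systems G. (i, j) \<notin> edges G \<longrightarrow> signal_dim G i j = 0) \<and>
     (\<forall>i\<in>systems G. A_mat G i \<in> carrier_mat (state_dim G i) (state_dim G i)) \<and>
     (\<forall>i\<in>systems G. \<forall>j\<in>nbrs G i.
        B_mat G i j \<in> carrier_mat (state_dim G i) (signal_dim G j i) \<and>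
        C_mat G i j \<in> carrier_mat (signal_dim G i j) (state_dim G i))"


section \<open>Trajectories, stability, removal of a system\<close>

text \<open>
  \<open>x i t\<close> is the state of system \<open>i\<close> at time \<open>t\<close>, and \<open>v i j t\<close>, \<open>w i j t\<close> are its input from and
  its output to system \<open>j\<close>.  Vectors over the reals carry no topology in this library, so the
  differential equations are stated componentwise, on the time interval \<open>{0..}\<close>.
\<close>

definition network_trajectory ::
    "lti_network \<Rightarrow> (nat \<Rightarrow> real \<Rightarrow> real vec) \<Rightarrow> (nat \<Rightarrow> nat \<Rightarrow> real \<Rightarrow> real vec)
      \<Rightarrow> (nat \<Rightarrow> nat \<Rightarrow> real \<Rightarrow> real vec) \<Rightarrow> bool" where
  "network_trajectory G x v w \<longleftrightarrow>
     (\<forall>t\<ge>0. \<forall>i\<in>systems G.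
        x i t \<in> carrier_vec (state_dim G i) \<and>
        (\<forall>j\<in>nbrs G i. v i j t \<in> carrier_vec (signal_dim G j i)) \<and>
        (\<forall>a<state_dim G i.
           ((\<lambda>s. x i s $ a) has_real_derivative
              (A_mat G i *\<^sub>v x i t +
               finsum_vec TYPE(real) (state_dim G i) (\<lambda>j. B_mat G i j *\<^sub>v v i j t) (nbrs G i)) $ a)
             (at t within {0..})) \<and>
        (\<forall>j\<in>nbrs G i. w i j t = C_mat G i j *\<^sub>v x i t)) \<and>
     (\<forall>t\<ge>0. \<forall>(i, j)\<in>edges G. v j i t = w i j t)"

text \<open>The Euclidean norm of \<open>col(x\<^sub>1, \<dots>, x\<^sub>N)\<close>.\<close>

definition state_norm :: "lti_network \<Rightarrow> (nat \<Rightarrow> real vec) \<Rightarrow> real" where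
  "state_norm G x = sqrt (\<Sum>i\<in>systems G. x i \<bullet> x i)"

text \<open>Asymptotic stability of the origin: Lyapunov stability and attractivity.\<close>

definition network_stable :: "lti_network \<Rightarrow> bool" where
  "network_stable G \<longleftrightarrow>
     (\<forall>\<epsilon>>0. \<exists>\<delta>>0. \<forall>x v w.
        network_trajectory G x v w \<longrightarrow> state_norm G (\<lambda>i. x i 0) < \<delta> \<longrightarrow>
        (\<forall>t\<ge>0. state_norm G (\<lambda>i. x i t) < \<epsilon>)) \<and>
     (\<forall>x v w. network_trajectory G x v w \<longrightarrow>
        ((\<lambda>t. state_norm G (\<lambda>i. x i t)) \<longlongrightarrow> 0) at_top)"

text \<open>
  With the edges incident to \<open>i\<close> the index \<open>i\<close> disappears from all sets \<open>nbrs G j\<close>, so the terms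
  \<open>B_mat G j i *\<^sub>v v j i t\<close> are dropped; this is the same as setting the inputs \<open>v j i\<close> to zero.
\<close>

definition remove_system :: "nat \<Rightarrow> lti_network \<Rightarrow> lti_network" where
  "remove_system i G = G\<lparr>topology :=
     \<lparr>pverts = systems G - {i}, parcs = {(j, k) \<in> edges G. j \<noteq> i \<and> k \<noteq> i}\<rparr>\<rparr>"

lemma valid_network_remove_system:
  assumes "valid_network G"
  shows "valid_network (remove_system i G)"
proof -
  interpret pair_digraph "topology G"
    using assms by (simp add: valid_network_def)
  have "pair_digraph (topology (remove_system i G))"
    using pair_finite_verts pair_finite_arcs pair_no_loops arc_fst_in_verts arc_snd_in_verts
    by unfold_locales
      (force simp: remove_system_def intro: finite_subset[where B = "edges G"])+
  then show ?thesis
    using assms by (auto simp: valid_network_def remove_system_def nbrs_def)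
qed


section \<open>The state matrix of the network\<close>

text \<open>
  The coordinates of \<open>col(x\<^sub>1, \<dots>, x\<^sub>N)\<close> in order: \<open>(i, a)\<close> stands for component \<open>a\<close> of \<open>x\<^sub>i\<close>.
\<close>

definition system_list :: "lti_network \<Rightarrow> nat list" where
  "system_list G = sorted_list_of_set (systems G)"

definition coords :: "lti_network \<Rightarrow> (nat \<times> nat) list" where
  "coords G = concat (map (\<lambda>i. map (Pair i) [0..<state_dim G i]) (system_list G))"

definition network_dim :: "lti_network \<Rightarrow> nat" where
  "network_dim G = length (coords G)"

definition col_vec :: "lti_network \<Rightarrow> (nat \<Rightarrow> real vec) \<Rightarrow> real vec" where
  "col_vec G x = vec (network_dim G) (\<lambda>p. case coords G ! p of (i, a) \<Rightarrow> x i $ a)"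

definition state_block :: "lti_network \<Rightarrow> nat \<Rightarrow> nat \<Rightarrow> real mat" where
  "state_block G i j =
     (if i = j then A_mat G i
      else if j \<in> nbrs G i then B_mat G i j * C_mat G j i
      else 0\<^sub>m (state_dim G i) (state_dim G j))"

text \<open>
  The matrix of the closed-loop equation obtained by substituting \<open>v i j = w j i\<close> and
  \<open>w j i = C_mat G j i *\<^sub>v x j\<close>; see \<open>network_trajectory_iff\<close> below.
\<close>

definition state_matrix :: "lti_network \<Rightarrow> real mat" where
  "state_matrix G = mat (network_dim G) (network_dim G)
     (\<lambda>(p, q). case (coords G ! p, coords G ! q) of
        ((i, a), (j, b)) \<Rightarrow> state_block G i j $$ (a, b))"


lemma finite_systems: "valid_network G \<Longrightarrow> finite (systems G)"
  by (simp add: valid_network_def pair_digraph_def pair_fin_digraph_def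
      pair_fin_digraph_axioms_def)

lemma nbrs_subset:
  assumes "valid_network G" shows "nbrs G i \<subseteq> systems G - {i}"
proof -
  interpret pair_digraph "topology G"
    using assms by (simp add: valid_network_def)
  show ?thesis
    by (auto simp: nbrs_def dest: in_arcsD1 in_arcsD2 pair_no_loops)
qed

lemma nbrs_sym: "j \<in> nbrs G i \<longleftrightarrow> i \<in> nbrs G j"
  by (auto simp: nbrs_def)

lemma mult_mat_dim:
  fixes M :: "real mat"
  assumes "M \<in> carrier_mat m n"
  shows "M *\<^sub>v u \<in> carrier_vec m"
  using assms by (metis carrier_vecI carrier_matD(1) dim_mult_mat_vec)

lemma B_carrier:
  assumes "valid_network G" "i \<in> systems G" "j \<in> nbrs G i"
  shows "B_mat G i j \<in> carrier_mat (state_dim G i) (signal_dim G j i)"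
  using assms by (simp add: valid_network_def)

lemma C_carrier:
  assumes "valid_network G" "i \<in> systems G" "j \<in> nbrs G i"
  shows "C_mat G j i \<in> carrier_mat (signal_dim G j i) (state_dim G j)"
proof -
  have "j \<in> systems G" "i \<in> nbrs G j"
    using nbrs_subset[OF assms(1), of i] assms(3) nbrs_sym by auto
  then show ?thesis
    using assms(1) by (simp add: valid_network_def)
qed

lemma set_coords:
  "valid_network G \<Longrightarrow> set (coords G) = Sigma (systems G) (\<lambda>i. {..<state_dim G i})"
  by (auto simp: coords_def system_list_def finite_systems)

lemma distinct_coords: "distinct (coords G)"
proof -
  have "distinct (concat (map (\<lambda>i. map (Pair i) [0..<n i]) xs))" if "distinct xs"
    for n :: "nat \<Rightarrow> nat" and xs :: "nat list"
    using that by (induction xs) (auto simp: distinct_map inj_on_def)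
  then show ?thesis
    by (simp add: coords_def system_list_def)
qed

lemma sum_coords:
  fixes f :: "nat \<times> nat \<Rightarrow> real"
  assumes "valid_network G"
  shows "(\<Sum>q<network_dim G. f (coords G ! q)) = (\<Sum>i\<in>systems G. \<Sum>a<state_dim G i. f (i, a))"
proof -
  have "(\<Sum>q<network_dim G. f (coords G ! q)) = sum f (set (coords G))"
    unfolding network_dim_def
    by (rule sum.reindex_bij_betw) (simp add: bij_betw_nth distinct_coords)
  also have "\<dots> = (\<Sum>i\<in>systems G. \<Sum>a<state_dim G i. f (i, a))"
    using assms by (simp add: set_coords sum.Sigma finite_systems)
  finally show ?thesis .
qed

lemma coords_nth:
  assumes "valid_network G" "p < network_dim G" "coords G ! p = (i, a)"
  shows "i \<in> systems G" "a < state_dim G i"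
proof -
  have "(i, a) \<in> set (coords G)"
    using assms by (metis network_dim_def nth_mem)
  then show "i \<in> systems G" "a < state_dim G i"
    using assms by (auto simp: set_coords)
qed

lemma state_norm_eq:
  assumes "valid_network G" "\<forall>i\<in>systems G. x i \<in> carrier_vec (state_dim G i)"
  shows "state_norm G x = sqrt (col_vec G x \<bullet> col_vec G x)"
proof -
  have "col_vec G x \<bullet> col_vec G x
      = (\<Sum>q<network_dim G. (\<lambda>(i, a). x i $ a * x i $ a) (coords G ! q))"
    by (auto simp: scalar_prod_def col_vec_def lessThan_atLeast0 split: prod.split intro!: sum.cong)
  also have "\<dots> = (\<Sum>i\<in>systems G. x i \<bullet> x i)"
    unfolding sum_coords[OF assms(1)] using assms(2)
    by (auto simp: scalar_prod_def lessThan_atLeast0 intro!: sum.cong)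
  finally show ?thesis by (simp add: state_norm_def)
qed

lemma state_matrix_mult:
  assumes G: "valid_network G" and x: "\<forall>i\<in>systems G. x i \<in> carrier_vec (state_dim G i)"
    and p: "p < network_dim G" "coords G ! p = (i, a)"
  shows "(state_matrix G *\<^sub>v col_vec G x) $ p =
    (A_mat G i *\<^sub>v x i + finsum_vec TYPE(real) (state_dim G i)
      (\<lambda>j. B_mat G i j *\<^sub>v (C_mat G j i *\<^sub>v x j)) (nbrs G i)) $ a"
proof -
  note ia = coords_nth[OF G p]
  note N = nbrs_subset[OF G, of i]
  have fin: "finite (nbrs G i)" using N finite_systems[OF G] finite_subset by blast
  have A: "A_mat G i \<in> carrier_mat (state_dim G i) (state_dim G i)"
    using G ia by (simp add: valid_network_def)
  have B: "B_mat G i j \<in> carrier_mat (state_dim G i) (signal_dim G j i)"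
    and C: "C_mat G j i \<in> carrier_mat (signal_dim G j i) (state_dim G j)"
    if "j \<in> nbrs G i" for j
    using B_carrier[OF G ia(1) that] C_carrier[OF G ia(1) that] by auto
  have Bv: "B_mat G i j *\<^sub>v u \<in> carrier_vec (state_dim G i)" if "j \<in> nbrs G i" for j u
    using mult_mat_dim[OF B[OF that]] .
  have blk: "state_block G i j \<in> carrier_mat (state_dim G i) (state_dim G j)" for j
    using A mult_carrier_mat[OF B C] by (auto simp: state_block_def)
  have mv: "(\<Sum>b<state_dim G j. state_block G i j $$ (a, b) * x j $ b)
      = (state_block G i j *\<^sub>v x j) $ a" if "j \<in> systems G" for j
    using blk[of j] x that ia by (auto simp: scalar_prod_def lessThan_atLeast0 intro!: sum.cong)
  have "(state_matrix G *\<^sub>v col_vec G x) $ p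
      = (\<Sum>q<network_dim G. (\<lambda>(j, b). state_block G i j $$ (a, b) * x j $ b) (coords G ! q))"
    using p by (auto simp: state_matrix_def col_vec_def scalar_prod_def lessThan_atLeast0
        split: prod.split intro!: sum.cong)
  also have "\<dots> = (\<Sum>j\<in>systems G. (state_block G i j *\<^sub>v x j) $ a)"
    unfolding sum_coords[OF G] by (simp add: mv)
  also have "\<dots> = (\<Sum>j\<in>insert i (nbrs G i). (state_block G i j *\<^sub>v x j) $ a)"
  proof (rule sum.mono_neutral_right)
    show "\<forall>j\<in>systems G - insert i (nbrs G i). (state_block G i j *\<^sub>v x j) $ a = 0"
      using x ia by (auto simp: state_block_def scalar_prod_def)
  qed (use finite_systems[OF G] N ia in auto)
  also have "\<dots> = (A_mat G i *\<^sub>v x i) $ a + (\<Sum>j\<in>nbrs G i. (state_block G i j *\<^sub>v x j) $ a)"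
    using fin N by (subst sum.insert) (auto simp: state_block_def)
  also have "(\<Sum>j\<in>nbrs G i. (state_block G i j *\<^sub>v x j) $ a)
      = (\<Sum>j\<in>nbrs G i. (B_mat G i j *\<^sub>v (C_mat G j i *\<^sub>v x j)) $ a)"
  proof (rule sum.cong)
    fix j assume j: "j \<in> nbrs G i"
    with N have "state_block G i j = B_mat G i j * C_mat G j i"
      by (auto simp: state_block_def)
    moreover have "x j \<in> carrier_vec (state_dim G j)"
      using x j N by auto
    ultimately show "(state_block G i j *\<^sub>v x j) $ a = (B_mat G i j *\<^sub>v (C_mat G j i *\<^sub>v x j)) $ a"
      using assoc_mult_mat_vec[OF B[OF j] C[OF j]] by simp
  qed simp
  also have "\<dots> = finsum_vec TYPE(real) (state_dim G i)
      (\<lambda>j. B_mat G i j *\<^sub>v (C_mat G j i *\<^sub>v x j)) (nbrs G i) $ a"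
    using Bv ia fin by (subst index_finsum_vec) auto
  finally have eq: "(state_matrix G *\<^sub>v col_vec G x) $ p = (A_mat G i *\<^sub>v x i) $ a +
    finsum_vec TYPE(real) (state_dim G i)
      (\<lambda>j. B_mat G i j *\<^sub>v (C_mat G j i *\<^sub>v x j)) (nbrs G i) $ a" .
  have "finsum_vec TYPE(real) (state_dim G i)
      (\<lambda>j. B_mat G i j *\<^sub>v (C_mat G j i *\<^sub>v x j)) (nbrs G i) \<in> carrier_vec (state_dim G i)"
    using Bv by (intro finsum_vec_closed) auto
  then show ?thesis
    using ia by (simp add: eq)
qed

text \<open>
  With all interconnection constraints imposed, the network is the system with matrix
  \<open>state_matrix G\<close> on the stacked state.
\<close>

theorem network_trajectory_iff:
  assumes G: "valid_network G"
  shows "(\<exists>v w. network_trajectory G x v w) \<longleftrightarrow>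
    (\<forall>t\<ge>0. (\<forall>i\<in>systems G. x i t \<in> carrier_vec (state_dim G i)) \<and>
      (\<forall>p<network_dim G. ((\<lambda>s. col_vec G (\<lambda>i. x i s) $ p) has_real_derivative
         (state_matrix G *\<^sub>v col_vec G (\<lambda>i. x i t)) $ p) (at t within {0..})))"
    (is "?L \<longleftrightarrow> ?R")
proof
  assume ?L
  then obtain v w where tr: "network_trajectory G x v w" by blast
  show ?R
  proof (intro allI impI conjI)
    fix t :: real assume t: "t \<ge> 0"
    show car: "\<forall>i\<in>systems G. x i t \<in> carrier_vec (state_dim G i)"
      using tr t by (simp add: network_trajectory_def)
    fix p assume p: "p < network_dim G"
    obtain i a where ia: "coords G ! p = (i, a)" by force
    note i = coords_nth[OF G p ia]
    have v: "v i j t = C_mat G j i *\<^sub>v x j t" if j: "j \<in> nbrs G i" for j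
    proof (cases "(j, i) \<in> edges G")
      case True
      moreover have "j \<in> systems G" "i \<in> nbrs G j"
        using j nbrs_subset[OF G, of i] nbrs_sym by auto
      ultimately show ?thesis
        using tr t unfolding network_trajectory_def by fastforce
    next
      case False
      have js: "j \<in> systems G" "i \<in> nbrs G j"
        using j nbrs_subset[OF G, of i] nbrs_sym by auto
      with False i G have "signal_dim G j i = 0"
        by (simp add: valid_network_def)
      moreover have "v i j t \<in> carrier_vec (signal_dim G j i)"
        using tr t i j by (simp add: network_trajectory_def)
      moreover have "dim_row (C_mat G j i) = signal_dim G j i"
        using C_carrier[OF G i(1) j] by simp
      ultimately show ?thesis by (intro eq_vecI) auto
    qed
    have "finsum_vec TYPE(real) (state_dim G i) (\<lambda>j. B_mat G i j *\<^sub>v v i j t) (nbrs G i) =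
      finsum_vec TYPE(real) (state_dim G i)
        (\<lambda>j. B_mat G i j *\<^sub>v (C_mat G j i *\<^sub>v x j t)) (nbrs G i)"
    proof -
      have "B_mat G i j *\<^sub>v (C_mat G j i *\<^sub>v x j t) \<in> carrier_vec (state_dim G i)"
        if "j \<in> nbrs G i" for j
        using mult_mat_dim[OF B_carrier[OF G i(1) that]] .
      then show ?thesis
        unfolding finsum_vec_def
        by (intro comm_monoid.finprod_cong'[OF comm_monoid_vec])
          (simp_all add: monoid_vec_simps v)
    qed
    note fs = this
    show "((\<lambda>s. col_vec G (\<lambda>i. x i s) $ p) has_real_derivative
         (state_matrix G *\<^sub>v col_vec G (\<lambda>i. x i t)) $ p) (at t within {0..})"
    proof -
      have "((\<lambda>s. x i s $ a) has_real_derivative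
              (A_mat G i *\<^sub>v x i t +
               finsum_vec TYPE(real) (state_dim G i) (\<lambda>j. B_mat G i j *\<^sub>v v i j t) (nbrs G i)) $ a)
             (at t within {0..})"
        using tr t i unfolding network_trajectory_def by blast
      then show ?thesis
        unfolding state_matrix_mult[OF G car p ia] fs using p ia by (simp add: col_vec_def)
    qed
  qed
next
  assume R: ?R
  define w where "w i j t = C_mat G i j *\<^sub>v x i t" for i j t
  have "network_trajectory G x (\<lambda>i j. w j i) w"
    unfolding network_trajectory_def
  proof (intro conjI allI impI ballI)
    fix t :: real and i assume t: "t \<ge> 0" and i: "i \<in> systems G"
    have car: "\<forall>i\<in>systems G. x i t \<in> carrier_vec (state_dim G i)"
      using R t by simp
    then show "x i t \<in> carrier_vec (state_dim G i)" using i by simp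
    show "w j i t \<in> carrier_vec (signal_dim G j i)" if "j \<in> nbrs G i" for j
      using mult_mat_dim[OF C_carrier[OF G i that]] by (simp add: w_def)
    fix a assume a: "a < state_dim G i"
    then have "(i, a) \<in> set (coords G)" using i G by (simp add: set_coords)
    then obtain p where p: "p < network_dim G" "coords G ! p = (i, a)"
      by (auto simp: in_set_conv_nth network_dim_def)
    have "((\<lambda>s. col_vec G (\<lambda>i. x i s) $ p) has_real_derivative
         (state_matrix G *\<^sub>v col_vec G (\<lambda>i. x i t)) $ p) (at t within {0..})"
      using R t p by blast
    then show "((\<lambda>s. x i s $ a) has_real_derivative
              (A_mat G i *\<^sub>v x i t +
               finsum_vec TYPE(real) (state_dim G i) (\<lambda>j. B_mat G i j *\<^sub>v w j i t) (nbrs G i)) $ a)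
             (at t within {0..})"
      unfolding state_matrix_mult[OF G car p] using p by (simp add: col_vec_def w_def)
  qed (auto simp: w_def)
  then show ?L by blast
qed


section \<open>Additive quadratic Lyapunov functions\<close>

definition pos_def_mat :: "real mat \<Rightarrow> bool" where
  "pos_def_mat M \<longleftrightarrow> square_mat M \<and> M\<^sup>T = M \<and>
     (\<forall>x\<in>carrier_vec (dim_row M). x \<noteq> 0\<^sub>v (dim_row M) \<longrightarrow> x \<bullet> (M *\<^sub>v x) > 0)"

definition neg_def_mat :: "real mat \<Rightarrow> bool" where
  "neg_def_mat M \<longleftrightarrow> pos_def_mat (- M)"

text \<open>The function \<open>V(x) = \<Sum>\<^sub>i x\<^sub>i\<^sup>T P\<^sub>i x\<^sub>i\<close> is given by the family \<open>P\<close>.\<close>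

definition additive_quadratic_lyapunov :: "lti_network \<Rightarrow> (nat \<Rightarrow> real mat) \<Rightarrow> bool" where
  "additive_quadratic_lyapunov G P \<longleftrightarrow>
     (\<forall>i\<in>systems G. P i \<in> carrier_mat (state_dim G i) (state_dim G i) \<and> pos_def_mat (P i)) \<and>
     (let PP = diag_block_mat (map P (system_list G)); AA = state_matrix G
      in neg_def_mat (AA\<^sup>T * PP + PP * AA))"

end

theory Submission
  imports Defs "HOL-Analysis.Function_Topology"
begin

text \<open>
  The Lyapunov inequality says that the quadratic form
  \<open>\<Sum>\<^sub>i \<Sum>\<^sub>j (P\<^sub>i x\<^sub>i)\<^sup>T (block i j) x\<^sub>j\<close> is negative definite, where without feed-through the block
  \<open>(i, j)\<close> of the state matrix depends only on the systems \<open>i\<close> and \<open>j\<close>.  Removing system \<open>r\<close>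
  amounts to restricting this form to the subspace \<open>x\<^sub>r = 0\<close>, so the same \<open>P\<^sub>i\<close> give a Lyapunov
  function of the remaining network.  As \<open>V\<close> and its derivative are comparable to the squared
  norm, \<open>V\<close> decays exponentially along trajectories.
\<close>

section \<open>Definite quadratic forms\<close>

text \<open>In this form the bounds, continuity and derivatives of quadratic forms become facts
  about finite sums of real products.\<close>

lemma scalar_prod_mult_mat_vec:
  fixes M :: "real mat"
  assumes "M \<in> carrier_mat m n" "x \<in> carrier_vec m" "y \<in> carrier_vec n"
  shows "x \<bullet> (M *\<^sub>v y) = (\<Sum>i<m. \<Sum>j<n. x $ i * (M $$ (i, j) * y $ j))"
proof -
  have "(M *\<^sub>v y) $ i = (\<Sum>j<n. M $$ (i, j) * y $ j)" if "i < m" for i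
    using assms that by (simp add: scalar_prod_def lessThan_atLeast0)
  then show ?thesis
    using assms by (simp add: scalar_prod_def lessThan_atLeast0 sum_distrib_left)
qed

lemma quadratic_form_uminus:
  fixes M :: "real mat"
  assumes M: "M \<in> carrier_mat n n" and x: "x \<in> carrier_vec n"
  shows "x \<bullet> (- M *\<^sub>v x) = - (x \<bullet> (M *\<^sub>v x))"
proof -
  have "- M \<in> carrier_mat n n" using M by simp
  then show ?thesis
    using M by (simp add: scalar_prod_mult_mat_vec[OF _ x x] flip: sum_negf)
qed

lemma neg_def_mat_iff:
  assumes M: "M \<in> carrier_mat n n" and sym: "M\<^sup>T = M"
  shows "neg_def_mat M \<longleftrightarrow> (\<forall>z\<in>carrier_vec n. z \<noteq> 0\<^sub>v n \<longrightarrow> z \<bullet> (M *\<^sub>v z) < 0)"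
  using M sym
  by (simp add: neg_def_mat_def pos_def_mat_def transpose_uminus quadratic_form_uminus[OF M])

text \<open>Every product of two coordinates is at most \<open>x \<bullet> x\<close> in absolute
  value, by the inequality between arithmetic and geometric means, so the sum of the absolute values
  of the entries bounds the form.\<close>

lemma quadratic_form_upper_bound:
  fixes M :: "real mat"
  assumes M: "M \<in> carrier_mat n n"
  shows "\<exists>c>0. \<forall>x\<in>carrier_vec n. x \<bullet> (M *\<^sub>v x) \<le> c * (x \<bullet> x)"
proof (intro exI conjI ballI)
  let ?S = "\<Sum>i<n. \<Sum>j<n. \<bar>M $$ (i, j)\<bar>"
  \<comment> \<open>The summand 1 keeps the constant strictly positive even when \<open>M\<close>
    vanishes or \<open>n = 0\<close>.\<close>
  show "1 + ?S > 0"
    by (smt (verit) sum_nonneg abs_ge_zero)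
  fix x :: "real vec" assume x: "x \<in> carrier_vec n"
  have sq: "x \<bullet> x = (\<Sum>i<n. (x $ i)\<^sup>2)"
    using x by (simp add: scalar_prod_def lessThan_atLeast0 power2_eq_square)
  have nonneg: "x \<bullet> x \<ge> 0"
    unfolding sq by (simp add: sum_nonneg)
  have prod: "\<bar>x $ i * x $ j\<bar> \<le> x \<bullet> x" if "i < n" "j < n" for i j
  proof -
    have "(x $ k)\<^sup>2 \<le> x \<bullet> x" if "k < n" for k
      unfolding sq using that by (intro member_le_sum) auto
    from this[OF \<open>i < n\<close>] this[OF \<open>j < n\<close>]
    have "\<bar>x $ i\<bar>\<^sup>2 + \<bar>x $ j\<bar>\<^sup>2 \<le> 2 * (x \<bullet> x)" by simp
    moreover have "2 * \<bar>x $ i\<bar> * \<bar>x $ j\<bar> \<le> \<bar>x $ i\<bar>\<^sup>2 + \<bar>x $ j\<bar>\<^sup>2"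
      by (rule sum_squares_bound)
    ultimately show ?thesis by (simp add: abs_mult)
  qed
  have "x \<bullet> (M *\<^sub>v x) \<le> (\<Sum>i<n. \<Sum>j<n. \<bar>M $$ (i, j)\<bar> * (x \<bullet> x))"
    unfolding scalar_prod_mult_mat_vec[OF M x x]
  proof (intro sum_mono)
    fix i j assume "i \<in> {..<n}" "j \<in> {..<n}"
    then have "\<bar>M $$ (i, j)\<bar> * \<bar>x $ i * x $ j\<bar> \<le> \<bar>M $$ (i, j)\<bar> * (x \<bullet> x)"
      using prod by (intro mult_left_mono) auto
    then show "x $ i * (M $$ (i, j) * x $ j) \<le> \<bar>M $$ (i, j)\<bar> * (x \<bullet> x)"
      using abs_ge_self[of "x $ i * (M $$ (i, j) * x $ j)"]
      by (simp add: abs_mult mult.left_commute)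
  qed
  also have "\<dots> = ?S * (x \<bullet> x)"
    by (simp add: sum_distrib_right)
  also have "\<dots> \<le> (1 + ?S) * (x \<bullet> x)"
    using nonneg by (simp add: distrib_right)
  finally show "x \<bullet> (M *\<^sub>v x) \<le> (1 + ?S) * (x \<bullet> x)" .
qed

text \<open>Points of the unit sphere are encoded as functions that vanish from \<open>n\<close> on,
  so that the product topology applies for variable \<open>n\<close>. The sphere is a closed subset
  of a box, which is compact by Tychonoff's theorem.\<close>

lemma compact_unit_sphere_fun:
  "compact {f :: nat \<Rightarrow> real. (\<forall>k\<ge>n. f k = 0) \<and> (\<Sum>k<n. (f k)\<^sup>2) = 1}"
    (is "compact ?K")
proof -
  \<comment> \<open>The singleton factors make the box itself enforce the vanishing from
    \<open>n\<close> on; only the norm condition remains as a closed constraint.\<close>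
  let ?I = "\<lambda>k. if k < n then {-1..1} else {0 :: real}"
  have "compactin (product_topology (\<lambda>_. euclidean) UNIV) (Pi\<^sub>E UNIV ?I)"
    by (subst compactin_PiE) auto
  then have box: "compact (Pi\<^sub>E UNIV ?I)"
    by (simp add: euclidean_product_topology)
  have "continuous_on UNIV (\<lambda>f :: nat \<Rightarrow> real. \<Sum>k<n. (f k)\<^sup>2)"
    by (intro continuous_intros) simp
  then have "closed ((\<lambda>f :: nat \<Rightarrow> real. \<Sum>k<n. (f k)\<^sup>2) -` {1})"
    by (intro closed_vimage) auto
  moreover have "?K = Pi\<^sub>E UNIV ?I \<inter> ((\<lambda>f. \<Sum>k<n. (f k)\<^sup>2) -` {1})"
  proof (intro Set.set_eqI iffI)
    fix f assume f: "f \<in> ?K"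
    have "f k \<in> ?I k" for k
    proof (cases "k < n")
      case True
      then have "(f k)\<^sup>2 \<le> 1"
        using f member_le_sum[of k "{..<n}" "\<lambda>k. (f k)\<^sup>2"] by simp
      then show ?thesis
        using True by (auto simp: abs_square_le_1)
    qed (use f in simp)
    with f show "f \<in> Pi\<^sub>E UNIV ?I \<inter> ((\<lambda>f. \<Sum>k<n. (f k)\<^sup>2) -` {1})"
      by (simp add: PiE_iff extensional_def)
  next
    fix f assume "f \<in> Pi\<^sub>E UNIV ?I \<inter> ((\<lambda>f. \<Sum>k<n. (f k)\<^sup>2) -` {1})"
    then have mem: "f k \<in> ?I k" and "(\<Sum>k<n. (f k)\<^sup>2) = 1" for k
      unfolding PiE_iff by blast+
    moreover have "f k = 0" if "k \<ge> n" for k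
      using mem[of k] that by simp
    ultimately show "f \<in> ?K" by simp
  qed
  ultimately show ?thesis
    using box by (simp add: compact_Int_closed)
qed

text \<open>The constant is the minimum of the form on the unit sphere. It is attained by
  compactness, hence positive by definiteness, and homogeneity of degree two carries the bound to
  all vectors.\<close>

lemma pos_def_mat_lower_bound:
  assumes M: "M \<in> carrier_mat n n" and pos: "pos_def_mat M"
  shows "\<exists>c>0. \<forall>x\<in>carrier_vec n. c * (x \<bullet> x) \<le> x \<bullet> (M *\<^sub>v x)"
proof (cases "n = 0")
  \<comment> \<open>In dimension zero the sphere is empty and has no minimum, but both sides vanish,
    so any constant works.\<close>
  case True
  then show ?thesis
    using M by (auto simp: scalar_prod_def intro!: exI[of _ 1])
next
  case False
  define q where "q f = (\<Sum>i<n. \<Sum>j<n. f i * (M $$ (i, j) * f j))" for f :: "nat \<Rightarrow> real"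
  define K where "K = {f :: nat \<Rightarrow> real. (\<forall>k\<ge>n. f k = 0) \<and> (\<Sum>k<n. (f k)\<^sup>2) = 1}"
  have q: "q f = vec n f \<bullet> (M *\<^sub>v vec n f)" for f
    using scalar_prod_mult_mat_vec[OF M, of "vec n f" "vec n f"] by (simp add: q_def)
  have "continuous_on K q"
    unfolding q_def by (intro continuous_intros) (auto intro: continuous_on_product_coordinates continuous_on_subset)
  moreover have "compact K"
    unfolding K_def by (rule compact_unit_sphere_fun)
  \<comment> \<open>The first unit vector shows that the sphere is nonempty.\<close>
  moreover have "(\<lambda>k. if k = 0 then 1 else 0) \<in> K"
  proof -
    have "(\<Sum>k<n. (if k = 0 then 1 else 0 :: real)\<^sup>2) = (\<Sum>k<n. if k = 0 then 1 else 0)"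
      by (intro sum.cong) auto
    also have "\<dots> = 1" using False by (simp add: sum.delta)
    finally show ?thesis using False by (auto simp: K_def)
  qed
  ultimately obtain f where f: "f \<in> K" and min: "\<And>g. g \<in> K \<Longrightarrow> q f \<le> q g"
    using continuous_attains_inf[of K q] by blast
  have "vec n f \<noteq> 0\<^sub>v n"
  proof
    assume "vec n f = 0\<^sub>v n"
    then have "f k = 0" if "k < n" for k
      using that by (metis index_vec index_zero_vec(1))
    then show False using f by (simp add: K_def)
  qed
  then have "q f > 0"
    using pos M unfolding q pos_def_mat_def by auto
  moreover have "q f * (x \<bullet> x) \<le> x \<bullet> (M *\<^sub>v x)" if x: "x \<in> carrier_vec n" for x
  proof (cases "x \<bullet> x = 0")
    case True
    have "x \<bullet> (M *\<^sub>v x) \<ge> 0"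
    proof (cases "x = 0\<^sub>v n")
      case True
      then show ?thesis using M by simp
    next
      case False
      then show ?thesis using pos x M unfolding pos_def_mat_def by (auto intro: less_imp_le)
    qed
    with True show ?thesis by simp
  next
    case False
    have sq: "x \<bullet> x = (\<Sum>i<n. (x $ i)\<^sup>2)"
      using x by (simp add: scalar_prod_def lessThan_atLeast0 power2_eq_square)
    then have xx: "x \<bullet> x > 0"
      using False by (metis sum_nonneg zero_le_power2 order_le_less)
    define r where "r = sqrt (x \<bullet> x)"
    have r: "r > 0" "r\<^sup>2 = x \<bullet> x"
      using xx by (auto simp: r_def)
    \<comment> \<open>This is \<open>x\<close> scaled to unit length, so its form value is that of
      \<open>x\<close> divided by \<open>r\<^sup>2\<close>.\<close>
    let ?g = "\<lambda>k. if k < n then x $ k / r else 0"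
    have "(\<Sum>k<n. (?g k)\<^sup>2) = (\<Sum>k<n. (x $ k)\<^sup>2) / r\<^sup>2"
      by (simp add: power_divide sum_divide_distrib)
    also have "\<dots> = 1" using r xx sq by simp
    finally have "?g \<in> K" by (simp add: K_def)
    then have "q f \<le> q ?g" by (rule min)
    also have "q ?g = (x \<bullet> (M *\<^sub>v x)) / r\<^sup>2"
      unfolding q_def scalar_prod_mult_mat_vec[OF M x x] sum_divide_distrib
      by (intro sum.cong) (auto simp: power2_eq_square)
    finally show ?thesis using r xx by (simp add: field_simps)
  qed
  ultimately show ?thesis by blast
qed


section \<open>Exponential decay\<close>

text \<open>The right-hand side has the shape that the product rule gives for the derivative of the
  form of \<open>P\<close> along a solution of \<open>z' = A z\<close>.\<close>

lemma lyapunov_form: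
  fixes A P :: "real mat"
  assumes A: "A \<in> carrier_mat n n" and P: "P \<in> carrier_mat n n" and z: "z \<in> carrier_vec n"
  shows "z \<bullet> ((A\<^sup>T * P + P * A) *\<^sub>v z) = (A *\<^sub>v z) \<bullet> (P *\<^sub>v z) + z \<bullet> (P *\<^sub>v (A *\<^sub>v z))"
proof -
  have Az: "A *\<^sub>v z \<in> carrier_vec n" and Pz: "P *\<^sub>v z \<in> carrier_vec n"
    using mult_mat_dim[OF A] mult_mat_dim[OF P] by auto
  have At: "A\<^sup>T \<in> carrier_mat n n" using A by simp
  have "(A\<^sup>T * P + P * A) *\<^sub>v z = A\<^sup>T *\<^sub>v (P *\<^sub>v z) + P *\<^sub>v (A *\<^sub>v z)"
    using At A P z by (simp add: add_mult_distrib_mat_vec[of _ n n] assoc_mult_mat_vec[of _ n n _ n])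
  moreover have "z \<bullet> (A\<^sup>T *\<^sub>v (P *\<^sub>v z)) = (A *\<^sub>v z) \<bullet> (P *\<^sub>v z)"
    using transpose_vec_mult_scalar[OF A z Pz] At Az Pz z
    by (metis comm_scalar_prod mult_mat_dim)
  ultimately show ?thesis
    using mult_mat_dim[OF At] mult_mat_dim[OF P] z by (simp add: scalar_prod_add_distrib[of _ n])
qed

text \<open>This is the product rule, applied to each summand of the coordinate expansion. A general
  set \<open>S\<close> covers the one-sided derivative at time 0.\<close>

lemma quadratic_form_has_real_derivative:
  fixes z :: "real \<Rightarrow> real vec"
  assumes P: "P \<in> carrier_mat n n"
    and z: "\<And>s. s \<in> S \<Longrightarrow> z s \<in> carrier_vec n" and t: "t \<in> S" and z': "z' \<in> carrier_vec n"
    and deriv: "\<And>p. p < n \<Longrightarrow> ((\<lambda>s. z s $ p) has_real_derivative z' $ p) (at t within S)"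
  shows "((\<lambda>s. z s \<bullet> (P *\<^sub>v z s)) has_real_derivative z' \<bullet> (P *\<^sub>v z t) + z t \<bullet> (P *\<^sub>v z'))
    (at t within S)"
proof -
  have "((\<lambda>s. \<Sum>i<n. \<Sum>j<n. z s $ i * (P $$ (i, j) * z s $ j)) has_real_derivative
      (\<Sum>i<n. \<Sum>j<n. z' $ i * (P $$ (i, j) * z t $ j) + z t $ i * (P $$ (i, j) * z' $ j)))
    (at t within S)"
    by (intro DERIV_sum) (auto intro!: derivative_eq_intros deriv)
  moreover have "(\<Sum>i<n. \<Sum>j<n. z' $ i * (P $$ (i, j) * z t $ j) + z t $ i * (P $$ (i, j) * z' $ j))
      = z' \<bullet> (P *\<^sub>v z t) + z t \<bullet> (P *\<^sub>v z')"
    by (simp add: scalar_prod_mult_mat_vec[OF P] z t z' sum.distrib)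
  ultimately have "((\<lambda>s. \<Sum>i<n. \<Sum>j<n. z s $ i * (P $$ (i, j) * z s $ j)) has_real_derivative
      z' \<bullet> (P *\<^sub>v z t) + z t \<bullet> (P *\<^sub>v z')) (at t within S)"
    by simp
  then show ?thesis
    \<comment> \<open>The expansion is known only for times in \<open>S\<close>, where
      \<open>z s\<close> has the right dimension; the radius 1 is arbitrary.\<close>
    by (rule has_field_derivative_transform_within[where d = 1])
      (simp_all add: scalar_prod_mult_mat_vec[OF P] z t)
qed

text \<open>With \<open>V\<close> the form of \<open>P\<close>, the derivative of \<open>V\<close>
  along solutions is at most \<open>- k * V\<close>, so \<open>exp (k * t) * V\<close> does not
  increase. Comparing \<open>V\<close> with the squared norm from both sides gives
  \<open>c = M / m\<close>. The constants are chosen before \<open>z\<close>, which makes the decay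
  uniform over all solutions.\<close>

lemma lyapunov_exponential_decay:
  assumes A: "A \<in> carrier_mat n n" and P: "P \<in> carrier_mat n n"
    and pos: "pos_def_mat P" and neg: "neg_def_mat (A\<^sup>T * P + P * A)"
  shows "\<exists>c>0. \<exists>k>0. \<forall>z. (\<forall>t\<ge>0. z t \<in> carrier_vec n \<and>
        (\<forall>p<n. ((\<lambda>s. z s $ p) has_real_derivative (A *\<^sub>v z t) $ p) (at t within {0..}))) \<longrightarrow>
      (\<forall>t\<ge>0. z t \<bullet> z t \<le> c * exp (- k * t) * (z 0 \<bullet> z 0))"
proof -
  let ?Q = "A\<^sup>T * P + P * A"
  have Q: "?Q \<in> carrier_mat n n" using A P by simp
  obtain m where m: "m > 0" "\<And>x. x \<in> carrier_vec n \<Longrightarrow> m * (x \<bullet> x) \<le> x \<bullet> (P *\<^sub>v x)"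
    using pos_def_mat_lower_bound[OF P pos] by blast
  obtain M where M: "M > 0" "\<And>x. x \<in> carrier_vec n \<Longrightarrow> x \<bullet> (P *\<^sub>v x) \<le> M * (x \<bullet> x)"
    using quadratic_form_upper_bound[OF P] by blast
  obtain d where d: "d > 0" "\<And>x. x \<in> carrier_vec n \<Longrightarrow> d * (x \<bullet> x) \<le> x \<bullet> (- ?Q *\<^sub>v x)"
    using pos_def_mat_lower_bound[of "- ?Q" n] neg Q unfolding neg_def_mat_def
    by (metis uminus_carrier_iff_mat)
  \<comment> \<open>Here \<open>d\<close> bounds the dissipation from below by the squared norm, and
    division by \<open>M\<close> converts the squared norm into \<open>V\<close>.\<close>
  define k where "k = d / M"
  have k: "k > 0" using d M by (simp add: k_def)
  have Q_le: "x \<bullet> (?Q *\<^sub>v x) \<le> - k * (x \<bullet> (P *\<^sub>v x))" if x: "x \<in> carrier_vec n" for x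
  proof -
    have "x \<bullet> (- ?Q *\<^sub>v x) = - (x \<bullet> (?Q *\<^sub>v x))"
      by (rule quadratic_form_uminus[OF Q x])
    moreover have "k * (x \<bullet> (P *\<^sub>v x)) \<le> k * (M * (x \<bullet> x))"
      using k M(2)[OF x] by (intro mult_left_mono) auto
    ultimately show ?thesis
      using d(2)[OF x] M(1) by (simp add: k_def)
  qed
  have "z t \<bullet> z t \<le> M / m * exp (- k * t) * (z 0 \<bullet> z 0)"
    if z: "\<And>t. t \<ge> 0 \<Longrightarrow> z t \<in> carrier_vec n"
      and ode: "\<And>t p. t \<ge> 0 \<Longrightarrow> p < n \<Longrightarrow>
        ((\<lambda>s. z s $ p) has_real_derivative (A *\<^sub>v z t) $ p) (at t within {0..})"
      and t: "t \<ge> 0" for z and t :: real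
  proof -
    define V where "V s = z s \<bullet> (P *\<^sub>v z s)" for s
    \<comment> \<open>Multiplication by the integrating factor reduces the differential inequality
      to monotonicity.\<close>
    define E where "E s = exp (k * s) * V s" for s
    have E': "(E has_real_derivative exp (k * s) * (k * V s + z s \<bullet> (?Q *\<^sub>v z s))) (at s within {0..})"
      if s: "s \<ge> 0" for s
    proof -
      have "(V has_real_derivative z s \<bullet> (?Q *\<^sub>v z s)) (at s within {0..})"
        unfolding V_def lyapunov_form[OF A P z[OF s]]
        using s z ode mult_mat_dim[OF A]
        by (intro quadratic_form_has_real_derivative[OF P]) auto
      then show ?thesis
        unfolding E_def by (auto intro!: derivative_eq_intros simp: algebra_simps)
    qed
    have "E t \<le> E 0"
    \<comment> \<open>At time 0 only a one-sided derivative is available. Inside the interval it is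
      two-sided, and continuity suffices at the end points.\<close>
    proof (rule DERIV_nonpos_imp_decreasing_open[OF t])
      fix s :: real assume s: "0 < s" "s < t"
      then have "(E has_real_derivative exp (k * s) * (k * V s + z s \<bullet> (?Q *\<^sub>v z s))) (at s)"
        using has_field_derivative_subset[OF E'[of s], of "{0<..}"] at_within_open[of s "{0<..}"]
        by (auto simp: greaterThan_subset_iff subset_iff)
      moreover have "exp (k * s) * (k * V s + z s \<bullet> (?Q *\<^sub>v z s)) \<le> 0"
        using Q_le[OF z[of s]] s by (auto simp: V_def mult_le_0_iff)
      ultimately show "\<exists>y. (E has_real_derivative y) (at s) \<and> y \<le> 0" by blast
    next
      show "continuous_on {0..t} E"
        by (rule DERIV_continuous_on, rule DERIV_subset[OF E']) auto
    qed
    then have "V t \<le> exp (- k * t) * V 0"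
      by (simp add: E_def exp_minus field_simps)
    also have "\<dots> \<le> exp (- k * t) * (M * (z 0 \<bullet> z 0))"
      using M(2)[OF z[of 0]] by (intro mult_left_mono) (auto simp: V_def)
    finally have "m * (z t \<bullet> z t) \<le> exp (- k * t) * (M * (z 0 \<bullet> z 0))"
      using m(2)[OF z[OF t]] by (simp add: V_def)
    then show ?thesis using m(1) by (simp add: field_simps)
  qed
  then show ?thesis
    using m(1) M(1) k by (intro exI[of _ "M / m"] exI[of _ k] conjI) auto
qed

section \<open>Block-diagonal matrices\<close>

lemma diag_four_block_mult_vec:
  fixes A D :: "real mat"
  assumes A: "A \<in> carrier_mat n n" and D: "D \<in> carrier_mat m m"
    and u: "u \<in> carrier_vec n" and v: "v \<in> carrier_vec m"
  shows "four_block_mat A (0\<^sub>m n m) (0\<^sub>m m n) D *\<^sub>v (u @\<^sub>v v) = (A *\<^sub>v u) @\<^sub>v (D *\<^sub>v v)"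
proof (rule eq_vecI)
  fix i assume "i < dim_vec ((A *\<^sub>v u) @\<^sub>v (D *\<^sub>v v))"
  then have i: "i < n + m" using A D by simp
  show "(four_block_mat A (0\<^sub>m n m) (0\<^sub>m m n) D *\<^sub>v (u @\<^sub>v v)) $ i
      = ((A *\<^sub>v u) @\<^sub>v (D *\<^sub>v v)) $ i"
  proof (cases "i < n")
    case True
    have "row (four_block_mat A (0\<^sub>m n m) (0\<^sub>m m n) D) i = row A i @\<^sub>v 0\<^sub>v m"
      using A D True by (intro eq_vecI) auto
    then show ?thesis
      using i True A D u v scalar_prod_append[of "row A i" n "0\<^sub>v m" m u v] by auto
  next
    case False
    have "row (four_block_mat A (0\<^sub>m n m) (0\<^sub>m m n) D) i = 0\<^sub>v n @\<^sub>v row D (i - n)"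
      using A D False i by (intro eq_vecI) auto
    then show ?thesis
      using i False A D u v scalar_prod_append[of "0\<^sub>v n" n "row D (i - n)" m u v] by auto
  qed
qed (use A D in simp)

text \<open>The form splits into the forms of the two diagonal blocks. Both are nonnegative, and a
  nonzero vector has a nonzero part on which one of them is positive.\<close>

lemma pos_def_mat_diag_four_block:
  assumes "pos_def_mat A" "pos_def_mat D"
    and A: "A \<in> carrier_mat n n" and D: "D \<in> carrier_mat m m"
  shows "pos_def_mat (four_block_mat A (0\<^sub>m n m) (0\<^sub>m m n) D)" (is "pos_def_mat ?F")
  unfolding pos_def_mat_def
proof (intro conjI ballI impI)
  show "square_mat ?F" using A D by simp
  show "?F\<^sup>T = ?F"
    using assms transpose_four_block_mat[OF A zero_carrier_mat zero_carrier_mat D]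
    by (simp add: pos_def_mat_def)
  have nonneg: "y \<bullet> (M *\<^sub>v y) \<ge> 0 \<and> (y \<bullet> (M *\<^sub>v y) = 0 \<longrightarrow> y = 0\<^sub>v l)"
    if "pos_def_mat M" "M \<in> carrier_mat l l" "y \<in> carrier_vec l" for M :: "real mat" and y l
    using that unfolding pos_def_mat_def
    by (cases "y = 0\<^sub>v l") (auto simp: order_less_le)
  fix x :: "real vec" assume "x \<in> carrier_vec (dim_row ?F)" and nz: "x \<noteq> 0\<^sub>v (dim_row ?F)"
  then have "x \<in> carrier_vec (n + m)" using A D by simp
  then obtain u v where x: "x = u @\<^sub>v v" and u: "u \<in> carrier_vec n" and v: "v \<in> carrier_vec m"
    by (metis vec_first_last_append vec_first_carrier vec_last_carrier)
  have form: "x \<bullet> (?F *\<^sub>v x) = u \<bullet> (A *\<^sub>v u) + v \<bullet> (D *\<^sub>v v)"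
    unfolding x diag_four_block_mult_vec[OF A D u v]
    by (rule scalar_prod_append[OF u v mult_mat_dim[OF A] mult_mat_dim[OF D]])
  have "0\<^sub>v n @\<^sub>v 0\<^sub>v m = (0\<^sub>v (n + m) :: real vec)" by (intro eq_vecI) auto
  then have "u \<noteq> 0\<^sub>v n \<or> v \<noteq> 0\<^sub>v m"
    using nz A D by (auto simp: x)
  then show "x \<bullet> (?F *\<^sub>v x) > 0"
    using nonneg[OF assms(1) A u] nonneg[OF assms(2) D v] unfolding form by argo
qed

lemma pos_def_mat_diag_block_mat:
  "(\<And>M. M \<in> set Ms \<Longrightarrow> pos_def_mat M) \<Longrightarrow> pos_def_mat (diag_block_mat Ms)"
proof (induction Ms)
  case Nil
  then show ?case by (auto simp: pos_def_mat_def)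
next
  case (Cons M Ms)
  have car: "M \<in> carrier_mat (dim_row M) (dim_row M)" if "pos_def_mat M" for M
    using that by (intro carrier_matI) (auto simp: pos_def_mat_def)
  have M: "pos_def_mat M" and Ms: "pos_def_mat (diag_block_mat Ms)"
    using Cons by auto
  show ?case
    using pos_def_mat_diag_four_block[OF M Ms car[OF M] car[OF Ms]] car[OF M] car[OF Ms]
    by (metis carrier_matD(2) diag_block_mat.simps(2))
qed

text \<open>Stacked vectors are written as concatenated lists so that the induction follows the
  recursion of \<open>diag_block_mat\<close>.\<close>

lemma diag_block_mat_mult_concat:
  fixes P :: "'a \<Rightarrow> real mat"
  assumes "\<And>i. i \<in> set is \<Longrightarrow> P i \<in> carrier_mat (n i) (n i) \<and> x i \<in> carrier_vec (n i)"
  shows "diag_block_mat (map P is) *\<^sub>v vec_of_list (concat (map (\<lambda>i. list_of_vec (x i)) is))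
    = vec_of_list (concat (map (\<lambda>i. list_of_vec (P i *\<^sub>v x i)) is))"
  using assms
proof (induction "is")
  case Nil
  then show ?case by (intro eq_vecI) auto
next
  case (Cons i "is")
  have append: "vec_of_list (list_of_vec u @ us) = u @\<^sub>v vec_of_list us" for u :: "real vec" and us
    by (metis list_of_vec_append list_vec vec_list)
  have car: "P i \<in> carrier_mat (n i) (n i)" "x i \<in> carrier_vec (n i)"
    using Cons.prems by auto
  let ?D = "diag_block_mat (map P is)" and ?m = "sum_list (map n is)"
  have "sum_list (map (\<lambda>i. dim_row (P i)) is) = ?m" "sum_list (map (\<lambda>i. dim_col (P i)) is) = ?m"
    "sum_list (map (\<lambda>i. dim_vec (x i)) is) = ?m"
    using Cons.prems by (intro arg_cong[where f = sum_list] map_cong; auto)+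
  then have D: "?D \<in> carrier_mat ?m ?m"
    and xs: "vec_of_list (concat (map (\<lambda>i. list_of_vec (x i)) is)) \<in> carrier_vec ?m"
    by (auto intro!: carrier_matI carrier_vecI simp: dim_diag_block_mat length_concat o_def)
  show ?case
    using diag_four_block_mult_vec[OF car(1) D car(2) xs] Cons.IH Cons.prems
    by (simp add: Let_def append carrier_matD[OF car(1)] carrier_matD[OF D])
qed

section \<open>The Lyapunov inequality in block form\<close>

text \<open>This connects the description of the stacked state through \<open>coords\<close> with
  the list form that block-diagonal products use.\<close>

lemma col_vec_eq_concat:
  assumes "valid_network G" "\<forall>i\<in>systems G. x i \<in> carrier_vec (state_dim G i)"
  shows "col_vec G x = vec_of_list (concat (map (\<lambda>i. list_of_vec (x i)) (system_list G)))"
proof -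
  have "concat (map (\<lambda>i. list_of_vec (x i)) (system_list G)) = map (\<lambda>(i, a). x i $ a) (coords G)"
    unfolding coords_def map_concat map_map
    using assms finite_systems[OF assms(1)]
    by (intro arg_cong[where f = concat] map_cong) (auto simp: list_of_vec_map system_list_def)
  then show ?thesis
    by (intro eq_vecI) (simp_all add: col_vec_def network_dim_def vec_of_list_index del: vec_of_list_map)
qed

lemma diag_block_mat_mult_col_vec:
  assumes "valid_network G" "\<forall>i\<in>systems G. x i \<in> carrier_vec (state_dim G i)"
    and "\<forall>i\<in>systems G. P i \<in> carrier_mat (state_dim G i) (state_dim G i)"
  shows "diag_block_mat (map P (system_list G)) *\<^sub>v col_vec G x = col_vec G (\<lambda>i. P i *\<^sub>v x i)"
proof -
  have "\<forall>i\<in>systems G. P i *\<^sub>v x i \<in> carrier_vec (state_dim G i)"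
    using assms(3) mult_mat_dim by blast
  then show ?thesis
    using assms finite_systems[OF assms(1)]
    by (simp add: col_vec_eq_concat)
      (rule diag_block_mat_mult_concat[where n = "state_dim G"], simp add: system_list_def)
qed

lemma diag_block_mat_carrier:
  assumes "valid_network G" "\<forall>i\<in>systems G. P i \<in> carrier_mat (state_dim G i) (state_dim G i)"
  shows "diag_block_mat (map P (system_list G)) \<in> carrier_mat (network_dim G) (network_dim G)"
proof -
  have "sum_list (map (\<lambda>i. dim_row (P i)) (system_list G)) = sum_list (map (state_dim G) (system_list G))"
    "sum_list (map (\<lambda>i. dim_col (P i)) (system_list G)) = sum_list (map (state_dim G) (system_list G))"
    using assms finite_systems[OF assms(1)]
    by (intro arg_cong[where f = sum_list] map_cong; auto simp: system_list_def)+
  then show ?thesis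
    by (intro carrier_matI)
      (simp_all add: dim_diag_block_mat network_dim_def coords_def length_concat o_def)
qed

lemma col_vec_carrier: "col_vec G x \<in> carrier_vec (network_dim G)"
  by (simp add: col_vec_def)

lemma state_matrix_carrier: "state_matrix G \<in> carrier_mat (network_dim G) (network_dim G)"
  by (simp add: state_matrix_def)

lemma state_block_carrier:
  assumes "valid_network G" "i \<in> systems G"
  shows "state_block G i j \<in> carrier_mat (state_dim G i) (state_dim G j)"
  using assms mult_carrier_mat[OF B_carrier C_carrier] valid_network_def
  by (auto simp: state_block_def)

text \<open>This allows a quantifier over stacked vectors to be replaced by one over families of
  local states.\<close>

lemma col_vec_surj:
  assumes G: "valid_network G" and z: "z \<in> carrier_vec (network_dim G)"
  obtains x where "\<And>i. x i \<in> carrier_vec (state_dim G i)" "col_vec G x = z"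
proof
  \<comment> \<open>The inverse of the enumeration \<open>coords\<close> locates each component in
    the stacked vector. Its values at pairs outside \<open>coords\<close> are arbitrary and do not
    affect \<open>col_vec\<close>.\<close>
  define idx where "idx = the_inv_into {..<network_dim G} ((!) (coords G))"
  let ?x = "\<lambda>i. vec (state_dim G i) (\<lambda>a. z $ idx (i, a))"
  show "?x i \<in> carrier_vec (state_dim G i)" for i by simp
  have "inj_on ((!) (coords G)) {..<network_dim G}"
    by (intro inj_on_nth[OF distinct_coords]) (simp add: network_dim_def)
  then have idx: "idx (coords G ! p) = p" if "p < network_dim G" for p
    using that by (simp add: idx_def the_inv_into_f_f)
  show "col_vec G ?x = z"
  proof (rule eq_vecI)
    fix p assume "p < dim_vec z"
    then have p: "p < network_dim G" using z by simp
    obtain i a where ia: "coords G ! p = (i, a)" by force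
    then show "col_vec G ?x $ p = z $ p"
      using p idx[OF p] coords_nth[OF G p ia] by (simp add: col_vec_def)
  qed (use z in \<open>simp add: col_vec_def\<close>)
qed

lemma state_matrix_bilinear:
  assumes G: "valid_network G"
    and x: "\<forall>i\<in>systems G. x i \<in> carrier_vec (state_dim G i)"
    and y: "\<forall>i\<in>systems G. y i \<in> carrier_vec (state_dim G i)"
  shows "col_vec G y \<bullet> (state_matrix G *\<^sub>v col_vec G x)
    = (\<Sum>i\<in>systems G. \<Sum>j\<in>systems G. y i \<bullet> (state_block G i j *\<^sub>v x j))"
proof -
  let ?n = "network_dim G"
  let ?f = "\<lambda>(i, a) (j, b). y i $ a * (state_block G i j $$ (a, b) * x j $ b)"
  have "col_vec G y \<bullet> (state_matrix G *\<^sub>v col_vec G x)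
      = (\<Sum>p<?n. \<Sum>q<?n. ?f (coords G ! p) (coords G ! q))"
    unfolding scalar_prod_mult_mat_vec[OF state_matrix_carrier col_vec_carrier col_vec_carrier]
    by (auto simp: col_vec_def state_matrix_def split: prod.split intro!: sum.cong)
  also have "\<dots> = (\<Sum>p<?n. \<Sum>j\<in>systems G. \<Sum>b<state_dim G j. ?f (coords G ! p) (j, b))"
    by (intro sum.cong sum_coords[OF G] refl)
  also have "\<dots> = (\<Sum>i\<in>systems G. \<Sum>a<state_dim G i. \<Sum>j\<in>systems G. \<Sum>b<state_dim G j.
      ?f (i, a) (j, b))"
    by (rule sum_coords[OF G])
  also have "\<dots> = (\<Sum>i\<in>systems G. \<Sum>j\<in>systems G. \<Sum>a<state_dim G i. \<Sum>b<state_dim G j.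
      ?f (i, a) (j, b))"
    by (intro sum.cong refl sum.swap)
  also have "\<dots> = (\<Sum>i\<in>systems G. \<Sum>j\<in>systems G. y i \<bullet> (state_block G i j *\<^sub>v x j))"
    using x y by (simp add: scalar_prod_mult_mat_vec[OF state_block_carrier[OF G]])
  finally show ?thesis .
qed

text \<open>Symmetry of the block-diagonal matrix makes the two terms of
  \<open>lyapunov_form\<close> equal, hence the factor 2. Its block structure lets each
  \<open>P i\<close> act on \<open>x i\<close> alone, so all coupling sits in the state
  blocks.\<close>

lemma lyapunov_form_blocks:
  assumes G: "valid_network G"
    and P: "\<forall>i\<in>systems G. P i \<in> carrier_mat (state_dim G i) (state_dim G i) \<and> pos_def_mat (P i)"
    and x: "\<forall>i\<in>systems G. x i \<in> carrier_vec (state_dim G i)"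
  shows "let PP = diag_block_mat (map P (system_list G)); AA = state_matrix G in
    col_vec G x \<bullet> ((AA\<^sup>T * PP + PP * AA) *\<^sub>v col_vec G x) =
    2 * (\<Sum>i\<in>systems G. \<Sum>j\<in>systems G. (P i *\<^sub>v x i) \<bullet> (state_block G i j *\<^sub>v x j))"
proof -
  let ?PP = "diag_block_mat (map P (system_list G))" and ?AA = "state_matrix G"
  let ?n = "network_dim G" and ?x = "col_vec G x"
  have PP: "?PP \<in> carrier_mat ?n ?n"
    using diag_block_mat_carrier[OF G] P by blast
  have "pos_def_mat ?PP"
    using P finite_systems[OF G] by (intro pos_def_mat_diag_block_mat) (auto simp: system_list_def)
  then have sym: "?PP\<^sup>T = ?PP" by (simp add: pos_def_mat_def)
  have Ax: "?AA *\<^sub>v ?x \<in> carrier_vec ?n" and Px: "?PP *\<^sub>v ?x \<in> carrier_vec ?n"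
    using mult_mat_dim[OF state_matrix_carrier] mult_mat_dim[OF PP] by auto
  have "?x \<bullet> (?PP *\<^sub>v (?AA *\<^sub>v ?x)) = (?PP *\<^sub>v ?x) \<bullet> (?AA *\<^sub>v ?x)"
    using transpose_vec_mult_scalar[OF PP Ax col_vec_carrier] by (simp add: sym)
  moreover have "(?AA *\<^sub>v ?x) \<bullet> (?PP *\<^sub>v ?x) = (?PP *\<^sub>v ?x) \<bullet> (?AA *\<^sub>v ?x)"
    by (rule comm_scalar_prod[OF Ax Px])
  moreover have "?PP *\<^sub>v ?x = col_vec G (\<lambda>i. P i *\<^sub>v x i)"
    using diag_block_mat_mult_col_vec[OF G x] P by blast
  moreover have "\<forall>i\<in>systems G. P i *\<^sub>v x i \<in> carrier_vec (state_dim G i)"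
    using P mult_mat_dim by blast
  ultimately show ?thesis
    using lyapunov_form[OF state_matrix_carrier PP col_vec_carrier] state_matrix_bilinear[OF G x]
    by (simp add: Let_def)
qed

text \<open>The matrix inequality becomes a sign condition on a sum over pairs of systems, in which
  deleting a system is easy to express. One direction is used for the given network, the other for
  the reduced one.\<close>

lemma additive_quadratic_lyapunov_iff:
  assumes G: "valid_network G"
  shows "additive_quadratic_lyapunov G P \<longleftrightarrow>
    (\<forall>i\<in>systems G. P i \<in> carrier_mat (state_dim G i) (state_dim G i) \<and> pos_def_mat (P i)) \<and>
    (\<forall>x. (\<forall>i. x i \<in> carrier_vec (state_dim G i)) \<longrightarrow>
      (\<exists>i\<in>systems G. x i \<noteq> 0\<^sub>v (state_dim G i)) \<longrightarrow>
      (\<Sum>i\<in>systems G. \<Sum>j\<in>systems G. (P i *\<^sub>v x i) \<bullet> (state_block G i j *\<^sub>v x j)) < 0)"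
    (is "_ \<longleftrightarrow> ?P \<and> ?neg")
proof (cases ?P)
  case P: True
  let ?PP = "diag_block_mat (map P (system_list G))" and ?AA = "state_matrix G"
  let ?n = "network_dim G" and ?Q = "?AA\<^sup>T * ?PP + ?PP * ?AA"
  have PP: "?PP \<in> carrier_mat ?n ?n"
    using diag_block_mat_carrier[OF G] P by blast
  have "pos_def_mat ?PP"
    using P finite_systems[OF G] by (intro pos_def_mat_diag_block_mat) (auto simp: system_list_def)
  then have sym: "?PP\<^sup>T = ?PP" by (simp add: pos_def_mat_def)
  have AA: "?AA \<in> carrier_mat ?n ?n" by (rule state_matrix_carrier)
  have Q: "?Q \<in> carrier_mat ?n ?n" using AA PP by simp
  \<comment> \<open>Symmetry is part of \<open>pos_def_mat\<close>, so it has to be established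
    before definiteness can be read off the form.\<close>
  have "?Q\<^sup>T = (?AA\<^sup>T * ?PP)\<^sup>T + (?PP * ?AA)\<^sup>T"
    using AA PP by (intro transpose_add) auto
  also have "\<dots> = ?PP * ?AA + ?AA\<^sup>T * ?PP"
    using AA PP by (simp add: transpose_mult[of _ ?n ?n _ ?n] sym)
  also have "\<dots> = ?Q"
    using AA PP by (intro comm_add_mat[of _ ?n ?n]) auto
  finally have Qsym: "?Q\<^sup>T = ?Q" .
  have zero: "col_vec G x = 0\<^sub>v ?n \<longleftrightarrow> (\<forall>i\<in>systems G. x i = 0\<^sub>v (state_dim G i))"
    if x: "\<forall>i. x i \<in> carrier_vec (state_dim G i)" for x
  proof
    assume z: "col_vec G x = 0\<^sub>v ?n"
    show "\<forall>i\<in>systems G. x i = 0\<^sub>v (state_dim G i)"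
    proof (intro ballI eq_vecI)
      fix i a assume i: "i \<in> systems G" and a: "a < dim_vec (0\<^sub>v (state_dim G i))"
      then have "(i, a) \<in> set (coords G)" by (simp add: set_coords[OF G])
      then obtain p where p: "p < ?n" "coords G ! p = (i, a)"
        by (auto simp: in_set_conv_nth network_dim_def)
      then have "col_vec G x $ p = x i $ a" by (simp add: col_vec_def)
      then show "x i $ a = 0\<^sub>v (state_dim G i) $ a" using z p a by simp
    qed (use x in auto)
  next
    assume "\<forall>i\<in>systems G. x i = 0\<^sub>v (state_dim G i)"
    then show "col_vec G x = 0\<^sub>v ?n"
      using coords_nth[OF G] by (intro eq_vecI) (auto simp: col_vec_def split: prod.split)
  qed
  have "neg_def_mat ?Q \<longleftrightarrow> (\<forall>z\<in>carrier_vec ?n. z \<noteq> 0\<^sub>v ?n \<longrightarrow> z \<bullet> (?Q *\<^sub>v z) < 0)"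
    by (rule neg_def_mat_iff[OF Q Qsym])
  also have "\<dots> \<longleftrightarrow> (\<forall>x. (\<forall>i. x i \<in> carrier_vec (state_dim G i)) \<longrightarrow> col_vec G x \<noteq> 0\<^sub>v ?n \<longrightarrow>
      col_vec G x \<bullet> (?Q *\<^sub>v col_vec G x) < 0)"
    (is "?L \<longleftrightarrow> ?R")
  proof
    show ?R if ?L using that col_vec_carrier by blast
  next
    assume ?R
    then show ?L using col_vec_surj[OF G] by metis
  qed
  also have "\<dots> \<longleftrightarrow> ?neg"
    using lyapunov_form_blocks[OF G P] zero by (auto simp: Let_def)
  finally show ?thesis
    using P by (simp add: additive_quadratic_lyapunov_def Let_def)
qed (auto simp: additive_quadratic_lyapunov_def)

section \<open>Stability and removal of a system\<close>

lemma additive_quadratic_lyapunov_stable: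
  assumes G: "valid_network G" and lyap: "additive_quadratic_lyapunov G P"
  shows "network_stable G"
proof -
  let ?PP = "diag_block_mat (map P (system_list G))" and ?n = "network_dim G"
  have P: "\<forall>i\<in>systems G. P i \<in> carrier_mat (state_dim G i) (state_dim G i) \<and> pos_def_mat (P i)"
    and neg: "neg_def_mat ((state_matrix G)\<^sup>T * ?PP + ?PP * state_matrix G)"
    using lyap by (auto simp: additive_quadratic_lyapunov_def Let_def)
  have PP: "?PP \<in> carrier_mat ?n ?n"
    using diag_block_mat_carrier[OF G] P by blast
  have pos: "pos_def_mat ?PP"
    using P finite_systems[OF G] by (intro pos_def_mat_diag_block_mat) (auto simp: system_list_def)
  obtain c k where c: "c > 0" and k: "k > 0" and decay: "\<And>z t. (\<forall>t\<ge>0. z t \<in> carrier_vec ?n \<and>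
        (\<forall>p<?n. ((\<lambda>s. z s $ p) has_real_derivative (state_matrix G *\<^sub>v z t) $ p)
          (at t within {0..}))) \<Longrightarrow> t \<ge> 0 \<Longrightarrow> z t \<bullet> z t \<le> c * exp (- k * t) * (z 0 \<bullet> z 0)"
    using lyapunov_exponential_decay[OF state_matrix_carrier PP pos neg] by blast
  \<comment> \<open>The decay estimate concerns squared norms, hence the square root of the
    factor.\<close>
  have bound: "state_norm G (\<lambda>i. x i t) \<le> sqrt (c * exp (- k * t)) * state_norm G (\<lambda>i. x i 0)"
    if tr: "network_trajectory G x v w" and t: "t \<ge> 0" for x v w and t :: real
  proof -
    have *: "(\<forall>i\<in>systems G. x i s \<in> carrier_vec (state_dim G i)) \<and>
      (\<forall>p<?n. ((\<lambda>s. col_vec G (\<lambda>i. x i s) $ p) has_real_derivative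
         (state_matrix G *\<^sub>v col_vec G (\<lambda>i. x i s)) $ p) (at s within {0..}))" if "s \<ge> 0" for s
      using tr network_trajectory_iff[OF G, of x] that by blast
    show ?thesis
      using decay[of "\<lambda>s. col_vec G (\<lambda>i. x i s)", OF _ t] * t
      by (simp add: state_norm_eq[OF G] col_vec_carrier flip: real_sqrt_mult)
  qed
  have nonneg: "state_norm G y \<ge> 0" for y
    by (auto simp: state_norm_def scalar_prod_def intro!: sum_nonneg)
  show ?thesis
    unfolding network_stable_def
  proof (intro conjI allI impI)
    fix \<epsilon> :: real assume \<epsilon>: "\<epsilon> > 0"
    show "\<exists>\<delta>>0. \<forall>x v w. network_trajectory G x v w \<longrightarrow> state_norm G (\<lambda>i. x i 0) < \<delta> \<longrightarrow>
        (\<forall>t\<ge>0. state_norm G (\<lambda>i. x i t) < \<epsilon>)"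
    \<comment> \<open>At every time \<open>t \<ge> 0\<close> the norm is at most
      \<open>sqrt c\<close> times its initial value.\<close>
    proof (intro exI[of _ "\<epsilon> / sqrt c"] conjI allI impI)
      show "\<epsilon> / sqrt c > 0" using \<epsilon> c by simp
      fix x v w and t :: real
      assume tr: "network_trajectory G x v w" and t: "t \<ge> 0"
        and x0: "state_norm G (\<lambda>i. x i 0) < \<epsilon> / sqrt c"
      have "state_norm G (\<lambda>i. x i t) \<le> sqrt (c * exp (- k * t)) * state_norm G (\<lambda>i. x i 0)"
        by (rule bound[OF tr t])
      also have "\<dots> \<le> sqrt c * state_norm G (\<lambda>i. x i 0)"
        using c k t nonneg by (intro mult_right_mono) auto
      also have "\<dots> < \<epsilon>"
        using x0 c by (simp add: field_simps)
      finally show "state_norm G (\<lambda>i. x i t) < \<epsilon>" .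
    qed
  next
    fix x v w assume tr: "network_trajectory G x v w"
    have "((\<lambda>t. exp (- k * t)) \<longlongrightarrow> 0) at_top"
      using k by (intro filterlim_compose[OF exp_at_bot] filterlim_tendsto_neg_mult_at_bot[OF tendsto_const])
        (auto intro: filterlim_ident)
    then have "((\<lambda>t. sqrt (c * exp (- k * t)) * state_norm G (\<lambda>i. x i 0)) \<longlongrightarrow>
        sqrt (c * 0) * state_norm G (\<lambda>i. x i 0)) at_top"
      by (intro tendsto_intros)
    then have lim: "((\<lambda>t. sqrt (c * exp (- k * t)) * state_norm G (\<lambda>i. x i 0)) \<longlongrightarrow> 0) at_top"
      by simp
    have "\<forall>\<^sub>F t in at_top. state_norm G (\<lambda>i. x i t)
        \<le> sqrt (c * exp (- k * t)) * state_norm G (\<lambda>i. x i 0)"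
      using eventually_ge_at_top[of 0] by (rule eventually_mono) (rule bound[OF tr])
    then show "((\<lambda>t. state_norm G (\<lambda>i. x i t)) \<longlongrightarrow> 0) at_top"
      by (rule tendsto_sandwich[OF always_eventually[OF allI[OF nonneg]] _ tendsto_const lim])
  qed
qed

lemma mult_mat_zero_vec:
  fixes M :: "real mat"
  assumes "M \<in> carrier_mat m n"
  shows "M *\<^sub>v 0\<^sub>v n = 0\<^sub>v m"
  using assms by (intro eq_vecI) auto

lemma additive_quadratic_lyapunov_remove_system:
  assumes G: "valid_network G" and lyap: "additive_quadratic_lyapunov G P"
  shows "additive_quadratic_lyapunov (remove_system r G) P"
proof -
  let ?H = "remove_system r G"
  note H = valid_network_remove_system[OF G, of r]
  have sys: "systems ?H = systems G - {r}" and dim: "state_dim ?H = state_dim G"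
    by (auto simp: remove_system_def)
  \<comment> \<open>Absence of feed-through enters here: a block involves only the matrices of
    \<open>i\<close> and \<open>j\<close> and their adjacency, none of which changes when another
    system is removed.\<close>
  have block: "state_block ?H i j = state_block G i j" if "i \<noteq> r" "j \<noteq> r" for i j
    using that by (auto simp: state_block_def remove_system_def nbrs_def)
  have P: "\<forall>i\<in>systems G. P i \<in> carrier_mat (state_dim G i) (state_dim G i) \<and> pos_def_mat (P i)"
    and neg: "\<And>x. (\<forall>i. x i \<in> carrier_vec (state_dim G i)) \<Longrightarrow>
      (\<exists>i\<in>systems G. x i \<noteq> 0\<^sub>v (state_dim G i)) \<Longrightarrow>
      (\<Sum>i\<in>systems G. \<Sum>j\<in>systems G. (P i *\<^sub>v x i) \<bullet> (state_block G i j *\<^sub>v x j)) < 0"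
    using lyap unfolding additive_quadratic_lyapunov_iff[OF G] by blast+
  have "(\<Sum>i\<in>systems ?H. \<Sum>j\<in>systems ?H. (P i *\<^sub>v x i) \<bullet> (state_block ?H i j *\<^sub>v x j)) < 0"
    if x: "\<forall>i. x i \<in> carrier_vec (state_dim G i)"
      and nz: "\<exists>i\<in>systems ?H. x i \<noteq> 0\<^sub>v (state_dim G i)" for x
  proof -
    \<comment> \<open>Zeroing the state of \<open>r\<close> embeds the states of the reduced network
      into those of \<open>G\<close>, where the sign condition is known.\<close>
    define y where "y = x(r := 0\<^sub>v (state_dim G r))"
    have y: "y i \<in> carrier_vec (state_dim G i)" for i
      using x by (simp add: y_def)
    have 0: "(P i *\<^sub>v y i) \<bullet> (state_block G i j *\<^sub>v y j) = 0"
      if i: "i \<in> systems G" and r: "i = r \<or> j = r" for i j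
    proof -
      have Pi: "P i \<in> carrier_mat (state_dim G i) (state_dim G i)"
        using P i by blast
      note Bij = state_block_carrier[OF G i, of j]
      have "P i *\<^sub>v y i = 0\<^sub>v (state_dim G i) \<or> state_block G i j *\<^sub>v y j = 0\<^sub>v (state_dim G i)"
        using r mult_mat_zero_vec[OF Pi] mult_mat_zero_vec[OF Bij] by (auto simp: y_def)
      then show ?thesis
        using mult_mat_dim[OF Pi] mult_mat_dim[OF Bij] by auto
    qed
    have "(\<Sum>i\<in>systems ?H. \<Sum>j\<in>systems ?H. (P i *\<^sub>v x i) \<bullet> (state_block ?H i j *\<^sub>v x j))
        = (\<Sum>i\<in>systems ?H. \<Sum>j\<in>systems ?H. (P i *\<^sub>v y i) \<bullet> (state_block G i j *\<^sub>v y j))"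
      by (intro sum.cong) (auto simp: sys block y_def)
    also have "\<dots> = (\<Sum>i\<in>systems ?H. \<Sum>j\<in>systems G. (P i *\<^sub>v y i) \<bullet> (state_block G i j *\<^sub>v y j))"
      using finite_systems[OF G] 0
      by (intro sum.cong sum.mono_neutral_left) (auto simp: sys)
    also have "\<dots> = (\<Sum>i\<in>systems G. \<Sum>j\<in>systems G. (P i *\<^sub>v y i) \<bullet> (state_block G i j *\<^sub>v y j))"
      using finite_systems[OF G] 0
      by (intro sum.mono_neutral_left) (auto simp: sys)
    \<comment> \<open>The nonzero local state of \<open>x\<close> belongs to a system other than
      \<open>r\<close>, so it survives in \<open>y\<close>.\<close>
    also have "\<dots> < 0"
      using nz y by (intro neg) (auto simp: y_def sys)
    finally show ?thesis .
  qed
  then show ?thesis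
    using P unfolding additive_quadratic_lyapunov_iff[OF H] dim by (auto simp: sys)
qed

theorem corollary5p4:
  fixes G :: lti_network
  assumes "valid_network G"
    and "\<exists>P. additive_quadratic_lyapunov G P"
  shows "\<forall>i\<in>systems G. network_stable (remove_system i G)"
  using assms valid_network_remove_system additive_quadratic_lyapunov_remove_system
    additive_quadratic_lyapunov_stable by blast

end
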